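(* Let $X$ be a real normed linear space, $\Omega\subseteq X$ a nonempty closed set, $v\in X$ nonzero, and $T(x):=\inf\{t\ge 0\mid x+tv\in\Omega\}$. For any $\bar x\in\operatorname{dom}T\setminus\Omega$, with $\tilde x:=\bar x+T(\bar x)v$, one has $$\partial T(\bar x)\subseteq\{x^*\in X^*\mid\langle x^*,v\rangle=-1\}\cap N(\tilde x;\Omega).$$ Suppose further that $T$ is lower calm around $\bar x$ and that $\Omega$ satisfies property $P$ around $\tilde x$ with the radius $r=T(\bar x)$. Then $$\partial T(\bar x)=\{x^*\in X^*\mid\langle x^*,v\rangle=-1\}\cap N(\tilde x;\Omega).$$ Here $\partial$ and $N$ denote the limiting (Mordukhovich) subdifferential and normal cone.
   Context: $T$ takes values in $[0,\infty]$ with $\inf\emptyset=\infty$, and $\operatorname{dom}T:=\{x\mid T(x)<\infty\}$; for $x\in\operatorname{dom}T$ the point $x+T(x)v$ lies in $\Omega$. $X^*$ is the topological dual of $X$. The Fréchet normal cone $\widehat N(y;\Omega)$ at $y\in\Omega$ is the set of $x^*\in X^*$ such that for every $\varepsilon>0$ there is $\delta>0$ with $\langle x^*,x-y\rangle\le\varepsilon\|x-y\|$ for all $x\in\Omega$ with $\|x-y\|\le\delta$. The limiting normal cone $N(y;\Omega)$ is the set of $x^*\in X^*$ for which there are sequences $x_k\to y$ with $x_k\in\Omega$, and $x_k^*\in\widehat N(x_k;\Omega)$ with $x_k^*\to x^*$ weak$^*$. For $\psi:X\to(-\infty,\infty]$ and $\psi(\bar x)<\infty$, the Fréchet subdifferential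 $\widehat\partial\psi(\bar x)$ is the set of $x^*\in X^*$ such that for every $\varepsilon>0$ there is $\delta>0$ with $\langle x^*,x-\bar x\rangle\le\psi(x)-\psi(\bar x)+\varepsilon\|x-\bar x\|$ whenever $\|x-\bar x\|\le\delta$. The limiting subdifferential $\partial\psi(\bar x)$ is the set of $x^*\in X^*$ for which there are sequences $x_k\to\bar x$ with $\psi(x_k)\to\psi(\bar x)$, and $x_k^*\in\widehat\partial\psi(x_k)$ with $x_k^*\to x^*$ weak$^*$. A function $\psi$ is lower calm at $x_0\in\operatorname{dom}\psi$ if there exist $\ell\in\mathbb R$ and $\delta>0$ such that $\psi(x)-\psi(x_0)\ge\ell\|x-x_0\|$ for all $x$ with $\|x-x_0\|\le\delta$; it is lower calm around $\bar x$ if it is lower calm at every point of $\operatorname{dom}\psi$ in some neighborhood of $\bar x$ ($\ell,\delta$ may depend on the point). $\Omega$ satisfies property $P$ around $\tilde x$ with radius $r>0$ if there is a neighborhood $V$ of $\tilde x$ such that $x-tv\notin\Omega$ for all $t\in(0,r]$ and all $x\in V\cap\operatorname{bd}\Omega$, where $\operatorname{bd}$ denotes the boundary. *)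

theory Defs
  imports "HOL-Analysis.Analysis"
begin

text \<open>
  The topological dual of \<open>'a\<close> is the type \<open>'a \<Rightarrow>\<^sub>L real\<close> of bounded linear functionals, and the pairing
  of \<open>f\<close> with \<open>x\<close> is \<open>blinfun_apply f x\<close>. Functions into \<open>(-\<infinity>,\<infinity>]\<close> are rendered as
  \<^typ>\<open>ereal\<close>-valued functions; the definitions below are meant for functions that never take the
  value \<open>-\<infinity>\<close>.
\<close>

definition dom_ereal :: "('a \<Rightarrow> ereal) \<Rightarrow> 'a set"
  where "dom_ereal \<psi> = {x. \<psi> x < \<infinity>}"

text \<open>The infimum is taken in \<^typ>\<open>ereal\<close>, where \<open>Inf {} = \<infinity>\<close>.\<close>

definition min_time :: "'a::real_normed_vector set \<Rightarrow> 'a \<Rightarrow> 'a \<Rightarrow> ereal"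
  where "min_time \<Omega> v x = Inf {ereal t | t. 0 \<le> t \<and> x + t *\<^sub>R v \<in> \<Omega>}"

text \<open>
  On functionals the strong operator topology is the topology of pointwise convergence, that is,
  the weak* topology.
\<close>

definition weak_star_tendsto ::
    "(nat \<Rightarrow> 'a::real_normed_vector \<Rightarrow>\<^sub>L real) \<Rightarrow> ('a \<Rightarrow>\<^sub>L real) \<Rightarrow> bool"
  where "weak_star_tendsto f g \<longleftrightarrow> limitin strong_operator_topology f g sequentially"

lemma weak_star_tendsto_iff_pointwise:
  "weak_star_tendsto f g \<longleftrightarrow> (\<forall>x. (\<lambda>k. blinfun_apply (f k) x) \<longlonglongrightarrow> blinfun_apply g x)"
proof -
  have "weak_star_tendsto f g \<longleftrightarrow>
      limitin euclidean (\<lambda>k. blinfun_apply (f k)) (blinfun_apply g) sequentially"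
  proof -
    have "(\<forall>S. (\<exists>U. open U \<and> S = blinfun_apply -` U) \<and> g \<in> S \<longrightarrow> (\<forall>\<^sub>F k in sequentially. f k \<in> S))
        \<longleftrightarrow> (\<forall>U. open U \<and> g \<in> blinfun_apply -` U \<longrightarrow>
              (\<forall>\<^sub>F k in sequentially. f k \<in> blinfun_apply -` U))"
      by blast
    then show ?thesis
      by (simp add: weak_star_tendsto_def limitin_def strong_operator_topology_def
          openin_pullback_topology topspace_pullback_topology del: limitin_canonical_iff)
  qed
  also have "\<dots> \<longleftrightarrow> (\<forall>x. (\<lambda>k. blinfun_apply (f k) x) \<longlonglongrightarrow> blinfun_apply g x)"
    using limitin_componentwise[of "\<lambda>_. euclideanreal" UNIV "\<lambda>k. blinfun_apply (f k)" "blinfun_apply g"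
        sequentially]
    by (simp add: euclidean_product_topology)
  finally show ?thesis .
qed

definition frechet_normal_cone :: "'a::real_normed_vector set \<Rightarrow> 'a \<Rightarrow> ('a \<Rightarrow>\<^sub>L real) set"
  where "frechet_normal_cone \<Omega> y =
    {f. y \<in> \<Omega> \<and>
      (\<forall>\<epsilon>>0. \<exists>\<delta>>0. \<forall>x\<in>\<Omega>. norm (x - y) \<le> \<delta> \<longrightarrow> blinfun_apply f (x - y) \<le> \<epsilon> * norm (x - y))}"

definition limiting_normal_cone :: "'a::real_normed_vector set \<Rightarrow> 'a \<Rightarrow> ('a \<Rightarrow>\<^sub>L real) set"
  where "limiting_normal_cone \<Omega> y =
    {f. \<exists>xs fs. xs \<longlonglongrightarrow> y \<and> (\<forall>k. xs k \<in> \<Omega>) \<and> (\<forall>k. fs k \<in> frechet_normal_cone \<Omega> (xs k)) \<and>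
      weak_star_tendsto fs f}"

text \<open>
  The inequality is one between extended reals. The subdifferential is empty
  outside the domain; the membership in \<^const>\<open>dom_ereal\<close> cannot be dropped, as \<open>\<infinity> - \<infinity> = \<infinity>\<close>
  in \<^typ>\<open>ereal\<close>.
\<close>

definition frechet_subdifferential ::
    "('a::real_normed_vector \<Rightarrow> ereal) \<Rightarrow> 'a \<Rightarrow> ('a \<Rightarrow>\<^sub>L real) set"
  where "frechet_subdifferential \<psi> y =
    {f. y \<in> dom_ereal \<psi> \<and>
      (\<forall>\<epsilon>>0. \<exists>\<delta>>0. \<forall>x. norm (x - y) \<le> \<delta> \<longrightarrow>
        ereal (blinfun_apply f (x - y)) \<le> \<psi> x - \<psi> y + ereal (\<epsilon> * norm (x - y)))}"

definition limiting_subdifferential ::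
    "('a::real_normed_vector \<Rightarrow> ereal) \<Rightarrow> 'a \<Rightarrow> ('a \<Rightarrow>\<^sub>L real) set"
  where "limiting_subdifferential \<psi> y =
    {f. y \<in> dom_ereal \<psi> \<and>
      (\<exists>xs fs. xs \<longlonglongrightarrow> y \<and> (\<lambda>k. \<psi> (xs k)) \<longlonglongrightarrow> \<psi> y \<and>
        (\<forall>k. fs k \<in> frechet_subdifferential \<psi> (xs k)) \<and> weak_star_tendsto fs f)}"

definition lower_calm_at :: "('a::real_normed_vector \<Rightarrow> ereal) \<Rightarrow> 'a \<Rightarrow> bool"
  where "lower_calm_at \<psi> x0 \<longleftrightarrow> x0 \<in> dom_ereal \<psi> \<and>
    (\<exists>l::real. \<exists>\<delta>>0. \<forall>x. norm (x - x0) \<le> \<delta> \<longrightarrow> \<psi> x - \<psi> x0 \<ge> ereal (l * norm (x - x0)))"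

definition lower_calm_around :: "('a::real_normed_vector \<Rightarrow> ereal) \<Rightarrow> 'a \<Rightarrow> bool"
  where "lower_calm_around \<psi> y \<longleftrightarrow>
    (\<exists>U. open U \<and> y \<in> U \<and> (\<forall>x0 \<in> U \<inter> dom_ereal \<psi>. lower_calm_at \<psi> x0))"

definition property_P :: "'a::real_normed_vector set \<Rightarrow> 'a \<Rightarrow> 'a \<Rightarrow> real \<Rightarrow> bool"
  where "property_P \<Omega> v y r \<longleftrightarrow> r > 0 \<and>
    (\<exists>V. open V \<and> y \<in> V \<and> (\<forall>t\<in>{0<..r}. \<forall>x \<in> V \<inter> frontier \<Omega>. x - t *\<^sub>R v \<notin> \<Omega>))"

end

theory Submission
  imports Defs
begin

text \<open>
  Along the line through \<open>x\<close> in direction \<open>v\<close> the function \<open>T\<close> decreases with slope \<open>-1\<close> until it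
  reaches \<open>\<Omega>\<close>, so every Frechet subgradient at \<open>x \<notin> \<Omega>\<close> takes the value \<open>-1\<close> at \<open>v\<close>; translating
  \<open>\<Omega>\<close> by \<open>-T(x)v\<close> lands in the sublevel set of \<open>T\<close> at level \<open>T(x)\<close>, so the subgradient is normal
  to \<open>\<Omega>\<close> at \<open>x + T(x)v\<close>. Conversely, a Frechet normal \<open>f\<close> to \<open>\<Omega>\<close> with \<open>f(v) < 0\<close>
  can be rescaled to \<open>f(v) = -1\<close> and lives at a boundary point \<open>y\<close>; property \<open>P\<close> gives
  \<open>T(y - T(xbar)v) = T(xbar)\<close>, and lower calmness makes \<open>T\<close> vary at most linearly near that point
  wherever the subgradient inequality is not trivially true.
\<close>

section \<open>The minimal time function and its attained values\<close>

lemma min_time_le: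
  assumes "0 \<le> t" "x + t *\<^sub>R v \<in> \<Omega>"
  shows "min_time \<Omega> v x \<le> ereal t"
  unfolding min_time_def using assms by (intro Inf_lower) auto

text \<open>The admissible times form a closed subset of the half-line, the preimage of
  \<open>\<Omega>\<close> under an affine map; a finite value makes it nonempty, so it contains its
  infimum.\<close>

lemma min_time_attained:
  assumes "closed \<Omega>" "min_time \<Omega> v x < \<infinity>"
  obtains t where "0 \<le> t" "min_time \<Omega> v x = ereal t" "x + t *\<^sub>R v \<in> \<Omega>"
proof -
  define S where "S = {0..} \<inter> (\<lambda>t. x + t *\<^sub>R v) -` \<Omega>"
  have "closed S"
    unfolding S_def by (intro closed_Int closed_atLeast closed_vimage assms continuous_intros)
  have "S \<noteq> {}"
  proof
    assume "S = {}"
    then have "{ereal t | t. 0 \<le> t \<and> x + t *\<^sub>R v \<in> \<Omega>} = {}" by (auto simp: S_def)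
    then have "min_time \<Omega> v x = \<infinity>"
      unfolding min_time_def by (simp only: Inf_empty top_ereal_def)
    with assms(2) show False by simp
  qed
  have bdd: "bdd_below S" by (intro bdd_belowI[of _ 0]) (auto simp: S_def)
  have "Inf S \<in> S" using \<open>closed S\<close> \<open>S \<noteq> {}\<close> bdd by (intro closed_contains_Inf)
  then have mem: "0 \<le> Inf S" "x + Inf S *\<^sub>R v \<in> \<Omega>" by (auto simp: S_def)
  have "ereal (Inf S) \<le> min_time \<Omega> v x"
    unfolding min_time_def
    by (intro Inf_greatest) (auto simp: S_def intro!: cInf_lower bdd_belowI[of _ 0])
  with min_time_le[OF mem] have "min_time \<Omega> v x = ereal (Inf S)" by simp
  with mem show thesis by (intro that)
qed

section \<open>First-order estimates along a direction\<close>

text \<open>By linearity the step length \<open>s\<close> cancels, leaving an error proportional to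
  \<open>\<epsilon>\<close>; hence one suitable \<open>s\<close> for each \<open>\<epsilon>\<close>
  is enough. Subgradients and normals both use this.\<close>

lemma blinfun_le_direction:
  fixes f :: "'a::real_normed_vector \<Rightarrow>\<^sub>L real"
  assumes "\<And>\<epsilon>. \<epsilon> > 0 \<Longrightarrow> \<exists>s>0. blinfun_apply f (s *\<^sub>R u) \<le> s * c + \<epsilon> * norm (s *\<^sub>R u)"
  shows "blinfun_apply f u \<le> c"
proof (rule field_le_epsilon)
  fix e :: real assume "e > 0"
  \<comment> \<open>The summand 1 covers \<open>u = 0\<close>; the resulting error is still at most
    \<open>e\<close>.\<close>
  then have "e / (norm u + 1) > 0" by (simp add: add_nonneg_pos)
  from assms[OF this] obtain s where s: "s > 0"
    "blinfun_apply f (s *\<^sub>R u) \<le> s * c + e / (norm u + 1) * norm (s *\<^sub>R u)" by blast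
  have "s * blinfun_apply f u \<le> s * (c + e * (norm u / (norm u + 1)))"
    using s by (simp add: blinfun.scaleR_right algebra_simps)
  then have "blinfun_apply f u \<le> c + e * (norm u / (norm u + 1))" using s(1) by simp
  moreover have "e * (norm u / (norm u + 1)) \<le> e * 1"
    using \<open>e > 0\<close> by (intro mult_left_mono) (auto simp: divide_simps add_nonneg_pos)
  ultimately show "blinfun_apply f u \<le> c + e" by simp
qed

text \<open>A real upper bound \<open>b\<close> in place of the extended value lets the inequality
  be applied to \<open>min_time\<close> when only some admissible time is known.\<close>

lemma frechet_subdifferential_upper_bound:
  assumes "f \<in> frechet_subdifferential \<psi> x" "\<psi> x = ereal a" "\<epsilon> > 0"
  obtains \<delta> where "\<delta> > 0"
    "\<And>x' b. norm (x' - x) \<le> \<delta> \<Longrightarrow> \<psi> x' \<le> ereal b \<Longrightarrow>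
       blinfun_apply f (x' - x) \<le> b - a + \<epsilon> * norm (x' - x)"
proof -
  from assms obtain \<delta> where \<delta>: "\<delta> > 0" "\<And>x'. norm (x' - x) \<le> \<delta> \<Longrightarrow>
      ereal (blinfun_apply f (x' - x)) \<le> \<psi> x' - ereal a + ereal (\<epsilon> * norm (x' - x))"
    by (auto simp: frechet_subdifferential_def)
  have "blinfun_apply f (x' - x) \<le> b - a + \<epsilon> * norm (x' - x)"
    if "norm (x' - x) \<le> \<delta>" "\<psi> x' \<le> ereal b" for x' b
  proof -
    have "\<psi> x' - ereal a + ereal (\<epsilon> * norm (x' - x)) \<le> ereal b - ereal a + ereal (\<epsilon> * norm (x' - x))"
      using that(2) by (intro add_right_mono ereal_minus_mono) auto
    with \<delta>(2)[OF that(1)] have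
      "ereal (blinfun_apply f (x' - x)) \<le> ereal b - ereal a + ereal (\<epsilon> * norm (x' - x))"
      by (rule order_trans)
    then show ?thesis by simp
  qed
  with \<delta>(1) show thesis by (rule that)
qed

text \<open>A Frechet subgradient minorizes \<open>\<psi>\<close> to first order, so an upper bound
  on the growth of \<open>\<psi>\<close> along a ray bounds its slope there. It is applied to
  \<open>v\<close> and \<open>- v\<close>.\<close>

lemma frechet_subdifferential_direction:
  assumes "f \<in> frechet_subdifferential \<psi> x" "\<psi> x = ereal a" "\<eta> > 0"
    and "\<And>s. 0 < s \<Longrightarrow> s \<le> \<eta> \<Longrightarrow> \<psi> (x + s *\<^sub>R u) \<le> ereal (a + s * c)"
  shows "blinfun_apply f u \<le> c"
proof (rule blinfun_le_direction)
  fix \<epsilon> :: real assume "\<epsilon> > 0"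
  from frechet_subdifferential_upper_bound[OF assms(1,2) this] obtain \<delta> where \<delta>: "\<delta> > 0"
    "\<And>x' b. norm (x' - x) \<le> \<delta> \<Longrightarrow> \<psi> x' \<le> ereal b \<Longrightarrow>
       blinfun_apply f (x' - x) \<le> b - a + \<epsilon> * norm (x' - x)" by blast
  \<comment> \<open>The first bound keeps the growth estimate valid, the second keeps the point
    within distance \<open>\<delta>\<close> of \<open>x\<close>.\<close>
  define s where "s = min \<eta> (\<delta> / (norm u + 1))"
  have s: "0 < s" "s \<le> \<eta>" "s * (norm u + 1) \<le> \<delta>"
    using \<open>\<eta> > 0\<close> \<delta>(1) by (auto simp: s_def add_nonneg_pos simp flip: pos_le_divide_eq)
  have "norm (x + s *\<^sub>R u - x) \<le> \<delta>" using s by (simp add: algebra_simps)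
  from \<delta>(2)[OF this assms(4)] s
  show "\<exists>s>0. blinfun_apply f (s *\<^sub>R u) \<le> s * c + \<epsilon> * norm (s *\<^sub>R u)"
    by (intro exI[of _ s]) auto
qed

lemma frechet_normal_cone_direction:
  assumes "f \<in> frechet_normal_cone \<Omega> y" "\<eta> > 0"
    and "\<And>s. 0 < s \<Longrightarrow> s \<le> \<eta> \<Longrightarrow> y + s *\<^sub>R u \<in> \<Omega>"
  shows "blinfun_apply f u \<le> 0"
proof (rule blinfun_le_direction)
  fix \<epsilon> :: real assume "\<epsilon> > 0"
  with assms(1) obtain \<delta> where \<delta>: "\<delta> > 0"
    "\<And>x. x \<in> \<Omega> \<Longrightarrow> norm (x - y) \<le> \<delta> \<Longrightarrow> blinfun_apply f (x - y) \<le> \<epsilon> * norm (x - y)"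
    by (auto simp: frechet_normal_cone_def)
  define s where "s = min \<eta> (\<delta> / (norm u + 1))"
  have s: "0 < s" "s \<le> \<eta>" "s * (norm u + 1) \<le> \<delta>"
    using \<open>\<eta> > 0\<close> \<delta>(1) by (auto simp: s_def add_nonneg_pos simp flip: pos_le_divide_eq)
  have "norm (y + s *\<^sub>R u - y) \<le> \<delta>" using s by (simp add: algebra_simps)
  from \<delta>(2)[OF assms(3) this] s
  show "\<exists>s>0. blinfun_apply f (s *\<^sub>R u) \<le> s * 0 + \<epsilon> * norm (s *\<^sub>R u)"
    by (intro exI[of _ s]) auto
qed

section \<open>Locating and rescaling Frechet normals\<close>

text \<open>At an interior point \<open>- u\<close> would be a feasible direction, forcing
  \<open>f\<close> to be nonnegative at \<open>u\<close>. This places normals at points where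
  property P applies.\<close>

lemma frechet_normal_cone_frontier:
  assumes "f \<in> frechet_normal_cone \<Omega> y" "blinfun_apply f u < 0"
  shows "y \<in> frontier \<Omega>"
proof -
  have "y \<in> \<Omega>" using assms(1) by (simp add: frechet_normal_cone_def)
  moreover have "y \<notin> interior \<Omega>"
  proof
    assume "y \<in> interior \<Omega>"
    then obtain e where e: "e > 0" "cball y e \<subseteq> \<Omega>" by (auto simp: mem_interior_cball)
    have "blinfun_apply f (- u) \<le> 0"
    proof (rule frechet_normal_cone_direction[OF assms(1)])
      show "e / (norm u + 1) > 0" using e(1) by (simp add: add_nonneg_pos)
      fix s assume s: "0 < s" "s \<le> e / (norm u + 1)"
      then have "s * (norm u + 1) \<le> e" by (simp add: pos_le_divide_eq add_nonneg_pos)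
      then have "y + s *\<^sub>R (- u) \<in> cball y e" using s(1) by (simp add: dist_norm algebra_simps)
      with e(2) show "y + s *\<^sub>R (- u) \<in> \<Omega>" by blast
    qed
    with assms(2) show False by (simp add: blinfun.minus_right)
  qed
  ultimately show ?thesis using closure_subset by (auto simp: frontier_def)
qed

text \<open>Allows normals whose values at \<open>v\<close> merely tend to -1 to be normalized to
  exactly -1.\<close>

lemma frechet_normal_cone_scaleR:
  assumes "f \<in> frechet_normal_cone \<Omega> y" "c > 0"
  shows "c *\<^sub>R f \<in> frechet_normal_cone \<Omega> y"
  unfolding frechet_normal_cone_def
proof (intro CollectI conjI allI impI)
  show "y \<in> \<Omega>" using assms(1) by (simp add: frechet_normal_cone_def)
  fix \<epsilon> :: real assume "\<epsilon> > 0"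
  then have "\<epsilon> / c > 0" using assms(2) by simp
  with assms(1) obtain \<delta> where \<delta>: "\<delta> > 0"
    "\<And>x. x \<in> \<Omega> \<Longrightarrow> norm (x - y) \<le> \<delta> \<Longrightarrow> blinfun_apply f (x - y) \<le> \<epsilon> / c * norm (x - y)"
    unfolding frechet_normal_cone_def by blast
  have "blinfun_apply (c *\<^sub>R f) (x - y) \<le> \<epsilon> * norm (x - y)"
    if "x \<in> \<Omega>" "norm (x - y) \<le> \<delta>" for x
    using mult_left_mono[OF \<delta>(2)[OF that], of c] assms(2) by (simp add: blinfun.scaleR_left)
  with \<delta>(1) show "\<exists>\<delta>>0. \<forall>x\<in>\<Omega>. norm (x - y) \<le> \<delta> \<longrightarrow>
      blinfun_apply (c *\<^sub>R f) (x - y) \<le> \<epsilon> * norm (x - y)" by blast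
qed

section \<open>Frechet subgradients of the minimal time function versus Frechet normals\<close>

lemma frechet_subdifferential_min_time:
  assumes "closed \<Omega>" "x \<notin> \<Omega>" "f \<in> frechet_subdifferential (min_time \<Omega> v) x"
  shows "blinfun_apply f v = -1"
    and "f \<in> frechet_normal_cone \<Omega> (x + real_of_ereal (min_time \<Omega> v x) *\<^sub>R v)"
proof -
  have "min_time \<Omega> v x < \<infinity>"
    using assms(3) by (simp add: frechet_subdifferential_def dom_ereal_def)
  with assms(1) obtain t where t: "0 \<le> t" "min_time \<Omega> v x = ereal t" "x + t *\<^sub>R v \<in> \<Omega>"
    by (rule min_time_attained)
  \<comment> \<open>Positivity of \<open>t\<close> leaves room to move from \<open>x\<close> towards
    \<open>\<Omega>\<close>.\<close>
  have "t \<noteq> 0" using t(3) assms(2) by (intro notI) simp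
  with t(1) have "t > 0" by simp
  have "blinfun_apply f v \<le> -1"
  proof (rule frechet_subdifferential_direction[OF assms(3) t(2) \<open>t > 0\<close>])
    fix s assume "0 < s" "s \<le> t"
    then have "min_time \<Omega> v (x + s *\<^sub>R v) \<le> ereal (t - s)"
      using t(3) by (intro min_time_le) (auto simp: algebra_simps)
    then show "min_time \<Omega> v (x + s *\<^sub>R v) \<le> ereal (t + s * -1)" by simp
  qed
  \<comment> \<open>Stepping back by \<open>s\<close> delays arrival by at most \<open>s\<close>;
    this gives the opposite bound on the value at \<open>v\<close>.\<close>
  moreover have "blinfun_apply f (- v) \<le> 1"
  proof (rule frechet_subdifferential_direction[OF assms(3) t(2) zero_less_one])
    fix s :: real assume "0 < s"
    then have "min_time \<Omega> v (x + s *\<^sub>R (- v)) \<le> ereal (t + s)"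
      using t by (intro min_time_le) (auto simp: algebra_simps)
    then show "min_time \<Omega> v (x + s *\<^sub>R (- v)) \<le> ereal (t + s * 1)" by simp
  qed
  ultimately show "blinfun_apply f v = -1" by (simp add: blinfun.minus_right)
  have "f \<in> frechet_normal_cone \<Omega> (x + t *\<^sub>R v)"
    unfolding frechet_normal_cone_def
  proof (intro CollectI conjI allI impI)
    show "x + t *\<^sub>R v \<in> \<Omega>" by (rule t(3))
    fix \<epsilon> :: real assume "\<epsilon> > 0"
    from frechet_subdifferential_upper_bound[OF assms(3) t(2) this] obtain \<delta> where \<delta>: "\<delta> > 0"
      "\<And>x' b. norm (x' - x) \<le> \<delta> \<Longrightarrow> min_time \<Omega> v x' \<le> ereal b \<Longrightarrow>
        blinfun_apply f (x' - x) \<le> b - t + \<epsilon> * norm (x' - x)" by blast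
    have "blinfun_apply f (z - (x + t *\<^sub>R v)) \<le> \<epsilon> * norm (z - (x + t *\<^sub>R v))"
      if "z \<in> \<Omega>" "norm (z - (x + t *\<^sub>R v)) \<le> \<delta>" for z
    proof -
      have eq: "z - (x + t *\<^sub>R v) = (z - t *\<^sub>R v) - x" by simp
      \<comment> \<open>With \<open>b = t\<close> the difference of values in the subgradient
        inequality vanishes, and only the error term of normality remains.\<close>
      have "min_time \<Omega> v (z - t *\<^sub>R v) \<le> ereal t" using t(1) that(1) by (intro min_time_le) auto
      from \<delta>(2)[OF that(2)[unfolded eq] this] show ?thesis unfolding eq by simp
    qed
    with \<delta>(1) show "\<exists>\<delta>>0. \<forall>z\<in>\<Omega>. norm (z - (x + t *\<^sub>R v)) \<le> \<delta> \<longrightarrow>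
        blinfun_apply f (z - (x + t *\<^sub>R v)) \<le> \<epsilon> * norm (z - (x + t *\<^sub>R v))" by blast
  qed
  with t(2) show "f \<in> frechet_normal_cone \<Omega> (x + real_of_ereal (min_time \<Omega> v x) *\<^sub>R v)" by simp
qed

text \<open>The difference \<open>w\<close> of the landing points of \<open>x'\<close> and
  \<open>x\<close> satisfies f(w) = f(x' - x) - (T(x') - T(x)), so normality gives the subgradient
  inequality with error proportional to the norm of \<open>w\<close>. It remains to bound that norm
  by a multiple of that of \<open>x' - x\<close>.\<close>

lemma frechet_normal_cone_imp_subdifferential:
  assumes "closed \<Omega>" "min_time \<Omega> v x = ereal t" "f \<in> frechet_normal_cone \<Omega> (x + t *\<^sub>R v)"
    and "blinfun_apply f v = -1" "lower_calm_at (min_time \<Omega> v) x"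
  shows "f \<in> frechet_subdifferential (min_time \<Omega> v) x"
  unfolding frechet_subdifferential_def
proof (intro CollectI conjI allI impI)
  show "x \<in> dom_ereal (min_time \<Omega> v)" by (simp add: dom_ereal_def assms(2))
  fix \<epsilon> :: real assume "\<epsilon> > 0"
  obtain l d where d: "d > 0"
    "\<And>x'. norm (x' - x) \<le> d \<Longrightarrow> ereal (l * norm (x' - x)) \<le> min_time \<Omega> v x' - ereal t"
    using assms(5) unfolding lower_calm_at_def assms(2) by blast
  \<comment> \<open>Dominating \<open>\<bar>l\<bar>\<close> turns calmness into a lower bound on
    \<open>\<tau> - t\<close>; dominating \<open>norm f\<close> settles the case of a large
    increase.\<close>
  define C where "C = max \<bar>l\<bar> (norm f)"
  have "C \<ge> 0" by (simp add: C_def)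
  \<comment> \<open>\<open>B\<close> is the factor by which \<open>w\<close> can exceed
    \<open>x' - x\<close> in norm; dividing both the error and the radius by it compensates.\<close>
  define B where "B = 1 + C * norm v"
  have "B > 0" using \<open>C \<ge> 0\<close> by (simp add: B_def add_pos_nonneg)
  have "\<epsilon> / B > 0" using \<open>\<epsilon> > 0\<close> \<open>B > 0\<close> by simp
  with assms(3) obtain e where e: "e > 0"
    "\<And>z. z \<in> \<Omega> \<Longrightarrow> norm (z - (x + t *\<^sub>R v)) \<le> e \<Longrightarrow>
      blinfun_apply f (z - (x + t *\<^sub>R v)) \<le> \<epsilon> / B * norm (z - (x + t *\<^sub>R v))"
    unfolding frechet_normal_cone_def by blast
  define \<delta> where "\<delta> = min d (e / B)"
  have "\<delta> > 0" using d(1) e(1) \<open>B > 0\<close> by (simp add: \<delta>_def)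
  moreover have "ereal (blinfun_apply f (x' - x))
      \<le> min_time \<Omega> v x' - min_time \<Omega> v x + ereal (\<epsilon> * norm (x' - x))"
    if "norm (x' - x) \<le> \<delta>" for x'
  proof (cases "min_time \<Omega> v x' < \<infinity>")
    case False
    then show ?thesis by (simp add: assms(2))
  next
    case True
    with assms(1) obtain \<tau> where \<tau>: "min_time \<Omega> v x' = ereal \<tau>" "x' + \<tau> *\<^sub>R v \<in> \<Omega>"
      by (rule min_time_attained)
    have "norm (x' - x) \<le> d" and ne: "norm (x' - x) * B \<le> e"
      using that \<open>B > 0\<close> by (auto simp: \<delta>_def pos_le_divide_eq)
    with d(2)[of x'] have lo: "l * norm (x' - x) \<le> \<tau> - t" by (simp add: \<tau>(1))
    have "blinfun_apply f (x' - x) \<le> \<tau> - t + \<epsilon> * norm (x' - x)"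
    \<comment> \<open>If the increase is this large, the operator norm bound on \<open>f\<close>
      suffices. Otherwise calmness supplies the missing side of a bound on
      \<open>\<bar>\<tau> - t\<bar>\<close>.\<close>
    proof (cases "\<tau> - t \<ge> C * norm (x' - x)")
      case True
      have "blinfun_apply f (x' - x) \<le> norm f * norm (x' - x)"
        using norm_blinfun[of f "x' - x"] by simp
      also have "\<dots> \<le> C * norm (x' - x)" by (intro mult_right_mono) (simp_all add: C_def)
      also have "\<dots> \<le> \<tau> - t + \<epsilon> * norm (x' - x)" using True \<open>\<epsilon> > 0\<close> by (simp add: add_increasing2)
      finally show ?thesis .
    next
      case False
      have "- C * norm (x' - x) \<le> l * norm (x' - x)"
        by (intro mult_right_mono) (auto simp: C_def)
      with lo False have tau: "\<bar>\<tau> - t\<bar> \<le> C * norm (x' - x)" by linarith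
      define w where "w = (x' + \<tau> *\<^sub>R v) - (x + t *\<^sub>R v)"
      have w: "w = (x' - x) + (\<tau> - t) *\<^sub>R v" by (simp add: w_def algebra_simps)
      have "norm w \<le> norm (x' - x) + \<bar>\<tau> - t\<bar> * norm v"
        unfolding w by (rule order_trans[OF norm_triangle_ineq]) simp
      also have "\<dots> \<le> norm (x' - x) + C * norm (x' - x) * norm v"
        by (intro add_left_mono mult_right_mono tau) simp
      finally have nw: "norm w \<le> norm (x' - x) * B" by (simp add: B_def algebra_simps)
      with ne have "norm w \<le> e" by simp
      then have "blinfun_apply f w \<le> \<epsilon> / B * norm w" using e(2)[OF \<tau>(2)] by (simp add: w_def)
      also have "\<dots> \<le> \<epsilon> / B * (norm (x' - x) * B)"
        using \<open>\<epsilon> / B > 0\<close> nw by (intro mult_left_mono) auto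
      also have "\<dots> = \<epsilon> * norm (x' - x)" using \<open>B > 0\<close> by simp
      finally show ?thesis
        using assms(4) by (simp add: w blinfun.add_right blinfun.scaleR_right)
    qed
    then show ?thesis by (simp add: \<tau>(1) assms(2))
  qed
  ultimately show "\<exists>\<delta>>0. \<forall>x'. norm (x' - x) \<le> \<delta> \<longrightarrow> ereal (blinfun_apply f (x' - x))
      \<le> min_time \<Omega> v x' - min_time \<Omega> v x + ereal (\<epsilon> * norm (x' - x))" by blast
qed

section \<open>Passage to weak* limits\<close>

lemma limiting_subdifferential_min_time_subset:
  assumes "closed \<Omega>" "xbar \<notin> \<Omega>"
  shows "limiting_subdifferential (min_time \<Omega> v) xbar
    \<subseteq> {f. blinfun_apply f v = -1}
      \<inter> limiting_normal_cone \<Omega> (xbar + real_of_ereal (min_time \<Omega> v xbar) *\<^sub>R v)"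
proof
  let ?T = "min_time \<Omega> v"
  fix f assume "f \<in> limiting_subdifferential ?T xbar"
  then obtain xs fs where dom: "xbar \<in> dom_ereal ?T"
    and xs: "xs \<longlonglongrightarrow> xbar" "(\<lambda>k. ?T (xs k)) \<longlonglongrightarrow> ?T xbar"
    and fs: "\<And>k. fs k \<in> frechet_subdifferential ?T (xs k)" "weak_star_tendsto fs f"
    by (auto simp: limiting_subdifferential_def)
  have "?T xbar < \<infinity>" using dom by (simp add: dom_ereal_def)
  with assms(1) obtain t where t: "?T xbar = ereal t" by (rule min_time_attained)
  \<comment> \<open>Convergence of the values is built into the limiting subdifferential; it makes
    the landing points converge without continuity of \<open>min_time\<close>.\<close>
  have "(\<lambda>k. real_of_ereal (?T (xs k))) \<longlonglongrightarrow> t"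
    using xs(2) unfolding t by (rule lim_real_of_ereal)
  then have ys: "(\<lambda>k. xs k + real_of_ereal (?T (xs k)) *\<^sub>R v) \<longlonglongrightarrow> xbar + t *\<^sub>R v"
    by (intro tendsto_add tendsto_scaleR tendsto_const xs(1))
  have "eventually (\<lambda>k. xs k \<in> - \<Omega>) sequentially"
    using assms by (intro topological_tendstoD[OF xs(1)]) auto
  \<comment> \<open>The Frechet lemma needs points outside \<open>\<Omega>\<close>, while the
    limiting cone asks for normals at every index; hence the shift by \<open>N\<close>.\<close>
  then obtain N where N: "\<And>k. k \<ge> N \<Longrightarrow> xs k \<notin> \<Omega>" by (auto simp: eventually_sequentially)
  have fv: "blinfun_apply (fs (k + N)) v = -1" for k
    by (rule frechet_subdifferential_min_time(1)[OF assms(1) N fs(1)]) simp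
  have normal: "fs (k + N) \<in> frechet_normal_cone \<Omega>
      (xs (k + N) + real_of_ereal (?T (xs (k + N))) *\<^sub>R v)" for k
    by (rule frechet_subdifferential_min_time(2)[OF assms(1) N fs(1)]) simp
  have lim: "(\<lambda>k. blinfun_apply (fs (k + N)) u) \<longlonglongrightarrow> blinfun_apply f u" for u
    using fs(2) by (intro LIMSEQ_ignore_initial_segment) (simp add: weak_star_tendsto_iff_pointwise)
  have "blinfun_apply f v = -1"
    using lim[of v] unfolding fv by (simp add: LIMSEQ_const_iff)
  moreover have "f \<in> limiting_normal_cone \<Omega> (xbar + t *\<^sub>R v)"
    unfolding limiting_normal_cone_def
  proof (intro CollectI exI conjI allI)
    show "(\<lambda>k. xs (k + N) + real_of_ereal (?T (xs (k + N))) *\<^sub>R v) \<longlonglongrightarrow> xbar + t *\<^sub>R v"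
      using ys by (rule LIMSEQ_ignore_initial_segment)
    show "weak_star_tendsto (\<lambda>k. fs (k + N)) f"
      using lim by (simp add: weak_star_tendsto_iff_pointwise)
    show "fs (k + N) \<in> frechet_normal_cone \<Omega>
        (xs (k + N) + real_of_ereal (?T (xs (k + N))) *\<^sub>R v)" for k by (rule normal)
    then show "xs (k + N) + real_of_ereal (?T (xs (k + N))) *\<^sub>R v \<in> \<Omega>" for k
      by (simp add: frechet_normal_cone_def)
  qed
  ultimately show "f \<in> {f. blinfun_apply f v = -1}
      \<inter> limiting_normal_cone \<Omega> (xbar + real_of_ereal (?T xbar) *\<^sub>R v)"
    by (simp add: t)
qed

lemma limiting_normal_cone_subset_subdifferential_min_time:
  assumes "closed \<Omega>" "min_time \<Omega> v xbar = ereal t"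
    and "lower_calm_around (min_time \<Omega> v) xbar" "property_P \<Omega> v (xbar + t *\<^sub>R v) t"
  shows "{f. blinfun_apply f v = -1} \<inter> limiting_normal_cone \<Omega> (xbar + t *\<^sub>R v)
    \<subseteq> limiting_subdifferential (min_time \<Omega> v) xbar"
proof
  let ?T = "min_time \<Omega> v"
  fix f assume "f \<in> {f. blinfun_apply f v = -1} \<inter> limiting_normal_cone \<Omega> (xbar + t *\<^sub>R v)"
  then obtain ys fs where fv: "blinfun_apply f v = -1" and ys: "ys \<longlonglongrightarrow> xbar + t *\<^sub>R v"
    and fs: "\<And>k. fs k \<in> frechet_normal_cone \<Omega> (ys k)" "weak_star_tendsto fs f"
    by (auto simp: limiting_normal_cone_def)
  have lim: "(\<lambda>k. blinfun_apply (fs k) u) \<longlonglongrightarrow> blinfun_apply f u" for u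
    using fs(2) by (simp add: weak_star_tendsto_iff_pointwise)
  from assms(3) obtain U where U: "open U" "xbar \<in> U"
    "\<And>x. x \<in> U \<Longrightarrow> x \<in> dom_ereal ?T \<Longrightarrow> lower_calm_at ?T x"
    by (auto simp: lower_calm_around_def)
  from assms(4) obtain V where "t > 0" and V: "open V" "xbar + t *\<^sub>R v \<in> V"
    "\<And>s y. 0 < s \<Longrightarrow> s \<le> t \<Longrightarrow> y \<in> V \<Longrightarrow> y \<in> frontier \<Omega> \<Longrightarrow> y - s *\<^sub>R v \<notin> \<Omega>"
    by (auto simp: property_P_def)
  \<comment> \<open>Shifting back by the fixed time \<open>t\<close> makes convergence to
    \<open>xbar\<close> immediate; that \<open>t\<close> is the minimal time at these points is
    shown afterwards.\<close>
  define xs where "xs k = ys k - t *\<^sub>R v" for k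
  have xs: "xs \<longlonglongrightarrow> xbar"
    unfolding xs_def using tendsto_diff[OF ys tendsto_const[of "t *\<^sub>R v"]] by simp
  \<comment> \<open>These factors normalize the values at \<open>v\<close> to -1 and tend to 1, so
    the weak* limit is unchanged.\<close>
  define c where "c k = inverse (- blinfun_apply (fs k) v)" for k
  have c: "c \<longlonglongrightarrow> 1"
    unfolding c_def using tendsto_inverse[OF tendsto_minus[OF lim[of v]]] fv by simp
  have "eventually (\<lambda>k. c k > 0) sequentially"
    using order_tendstoD(1)[OF c, of 0] by simp
  moreover have "eventually (\<lambda>k. ys k \<in> V) sequentially"
    using V by (intro topological_tendstoD[OF ys])
  moreover have "eventually (\<lambda>k. xs k \<in> U) sequentially"
    using U by (intro topological_tendstoD[OF xs])
  ultimately have "eventually (\<lambda>k. c k > 0 \<and> ys k \<in> V \<and> xs k \<in> U) sequentially"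
    by eventually_elim auto
  then obtain N where N: "\<And>k. k \<ge> N \<Longrightarrow> c k > 0" "\<And>k. k \<ge> N \<Longrightarrow> ys k \<in> V" "\<And>k. k \<ge> N \<Longrightarrow> xs k \<in> U"
    by (auto simp: eventually_sequentially)
  have T: "?T (xs k) = ereal t" and sub: "c k *\<^sub>R fs k \<in> frechet_subdifferential ?T (xs k)"
    if "k \<ge> N" for k
  proof -
    \<comment> \<open>Since \<open>inverse 0 = 0\<close>, positivity of \<open>c k\<close> also
      excludes the value 0.\<close>
    have neg: "blinfun_apply (fs k) v < 0" using N(1)[OF that] by (simp add: c_def)
    have y: "xs k + t *\<^sub>R v = ys k" by (simp add: xs_def)
    have "ys k \<in> \<Omega>" using fs(1)[of k] by (simp add: frechet_normal_cone_def)
    have front: "ys k \<in> frontier \<Omega>" using fs(1) neg by (rule frechet_normal_cone_frontier)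
    have le: "?T (xs k) \<le> ereal t"
      using \<open>t > 0\<close> \<open>ys k \<in> \<Omega>\<close> y by (intro min_time_le) auto
    then have "?T (xs k) < \<infinity>" by auto
    with assms(1) obtain \<tau> where \<tau>: "0 \<le> \<tau>" "?T (xs k) = ereal \<tau>" "xs k + \<tau> *\<^sub>R v \<in> \<Omega>"
      by (rule min_time_attained)
    \<comment> \<open>An earlier arrival would put the point
      \<open>ys k - (t - \<tau>) *\<^sub>R v\<close> in \<open>\<Omega>\<close>; as
      \<open>0 < t - \<tau>\<close> and \<open>t - \<tau> \<le> t\<close>, property P with radius
      \<open>t\<close> forbids this.\<close>
    have "\<not> \<tau> < t"
    proof
      assume "\<tau> < t"
      then have "ys k - (t - \<tau>) *\<^sub>R v \<notin> \<Omega>"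
        using \<tau>(1) by (intro V(3) N(2)[OF that] front) auto
      moreover have "ys k - (t - \<tau>) *\<^sub>R v = xs k + \<tau> *\<^sub>R v" by (simp add: xs_def algebra_simps)
      ultimately show False using \<tau>(3) by simp
    qed
    with le show "?T (xs k) = ereal t" by (simp add: \<tau>(2))
    moreover from this have "lower_calm_at ?T (xs k)"
      by (intro U(3) N(3)[OF that]) (simp add: dom_ereal_def)
    moreover have "c k *\<^sub>R fs k \<in> frechet_normal_cone \<Omega> (xs k + t *\<^sub>R v)"
      unfolding y using fs(1) N(1)[OF that] by (rule frechet_normal_cone_scaleR)
    moreover have "blinfun_apply (c k *\<^sub>R fs k) v = -1"
      using neg by (simp add: c_def blinfun.scaleR_left blinfun.minus_left)
    ultimately show "c k *\<^sub>R fs k \<in> frechet_subdifferential ?T (xs k)"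
      using assms(1) by (intro frechet_normal_cone_imp_subdifferential)
  qed
  show "f \<in> limiting_subdifferential ?T xbar"
    unfolding limiting_subdifferential_def
  proof (intro CollectI exI conjI allI)
    show "xbar \<in> dom_ereal ?T" by (simp add: dom_ereal_def assms(2))
    show "(\<lambda>k. xs (k + N)) \<longlonglongrightarrow> xbar" using xs by (rule LIMSEQ_ignore_initial_segment)
    \<comment> \<open>The values are constantly \<open>t\<close> along the shifted sequence.\<close>
    show "(\<lambda>k. ?T (xs (k + N))) \<longlonglongrightarrow> ?T xbar" by (simp add: T assms(2))
    show "c (k + N) *\<^sub>R fs (k + N) \<in> frechet_subdifferential ?T (xs (k + N))" for k
      by (rule sub) simp
    have "(\<lambda>k. blinfun_apply (c k *\<^sub>R fs k) u) \<longlonglongrightarrow> blinfun_apply f u" for u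
      using tendsto_mult[OF c lim[of u]] by (simp add: blinfun.scaleR_left)
    then show "weak_star_tendsto (\<lambda>k. c (k + N) *\<^sub>R fs (k + N)) f"
      unfolding weak_star_tendsto_iff_pointwise
      by (intro allI LIMSEQ_ignore_initial_segment[where f = "\<lambda>k. blinfun_apply (c k *\<^sub>R fs k) _"])
  qed
qed

theorem theorem3p19:
  fixes \<Omega> :: "'a::real_normed_vector set" and v xbar xtilde :: 'a
  assumes "closed \<Omega>" and "\<Omega> \<noteq> {}" and "v \<noteq> 0"
    and "xbar \<in> dom_ereal (min_time \<Omega> v) - \<Omega>"
    and "xtilde = xbar + real_of_ereal (min_time \<Omega> v xbar) *\<^sub>R v"
  shows "limiting_subdifferential (min_time \<Omega> v) xbar
           \<subseteq> {f. blinfun_apply f v = -1} \<inter> limiting_normal_cone \<Omega> xtilde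
    \<and> (lower_calm_around (min_time \<Omega> v) xbar
         \<and> property_P \<Omega> v xtilde (real_of_ereal (min_time \<Omega> v xbar))
       \<longrightarrow> limiting_subdifferential (min_time \<Omega> v) xbar
           = {f. blinfun_apply f v = -1} \<inter> limiting_normal_cone \<Omega> xtilde)"
proof -
  have "min_time \<Omega> v xbar < \<infinity>" using assms(4) by (simp add: dom_ereal_def)
  with assms(1) obtain t where t: "min_time \<Omega> v xbar = ereal t" by (rule min_time_attained)
  have sub: "limiting_subdifferential (min_time \<Omega> v) xbar
      \<subseteq> {f. blinfun_apply f v = -1} \<inter> limiting_normal_cone \<Omega> xtilde"
    using limiting_subdifferential_min_time_subset[OF assms(1)] assms(4) unfolding assms(5) by blast
  have "xtilde = xbar + t *\<^sub>R v" by (simp add: assms(5) t)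
  then have "{f. blinfun_apply f v = -1} \<inter> limiting_normal_cone \<Omega> xtilde
      \<subseteq> limiting_subdifferential (min_time \<Omega> v) xbar"
    if "lower_calm_around (min_time \<Omega> v) xbar"
      "property_P \<Omega> v xtilde (real_of_ereal (min_time \<Omega> v xbar))"
    using limiting_normal_cone_subset_subdifferential_min_time[OF assms(1) t] that
    by (simp add: t)
  with sub show ?thesis by blast
qed

end
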